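(* Let $\mathcal{S}_p^+$ be the cone of (symmetric) positive definite $p\times p$ real matrices, let $\lambda=[\lambda_1\ \ldots\ \lambda_p]^T$ with $0<\lambda_i<1$ for all $i$, and let $F_\lambda:\mathcal{S}_p^+\to\mathcal{S}_p^+$ be a map. Let $y(t)\in\mathbb{R}$ and $\varphi(t)\in\mathbb{R}^p$ for $t\ge1$, and let $\hat\theta_0\in\mathbb{R}^p$ and $R_0\in\mathcal{S}_p^+$ be given. For $t\ge 1$ define $$\hat\theta_t=\operatorname*{argmin}_{\theta_t\in\mathbb{R}^p}\ \bigl(y(t)-\varphi(t)^T\theta_t\bigr)^2+(\theta_t-\hat\theta_{t-1})^T F_\lambda(R_{t-1})(\theta_t-\hat\theta_{t-1}),$$ $$R_t=F_\lambda(R_{t-1})+\varphi(t)\varphi(t)^T .$$ Then, for every $t\ge1$, the solution is given by the recursion $$\hat\theta_t=\hat\theta_{t-1}+K_t\bigl(y(t)-\varphi(t)^T\hat\theta_{t-1}\bigr),\qquad K_t=R_t^{-1}\varphi(t),\qquad R_t=F_\lambda(R_{t-1})+\varphi(t)\varphi(t)^T .$$ Moreover, setting $P_t=R_t^{-1}$, the gain $K_t$ can be updated in the equivalent way $$K_t=\frac{F_\lambda(P_{t-1}^{-1})^{-1}\varphi(t)}{1+\varphi(t)^T F_\lambda(P_{t-1}^{-1})^{-1}\varphi(t)},\qquad P_t=\bigl(I-K_t\varphi(t)^T\bigr)F_\lambda(P_{t-1}^{-1})^{-1}.$$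
   Context: The setting is recursive least-squares identification of a SISO ARX model with output $y(t)\in\mathbb{R}$ and input $u(t)\in\mathbb{R}$. Here $p=n+m$ and $\varphi(t)=[\,y(t-1)\ \ldots\ y(t-n)\ \ u(t-1)\ \ldots\ u(t-m)\,]^T\in\mathbb{R}^p$ is the regression vector. The map $F_\lambda$ is called the forgetting map and $\lambda$ the forgetting vector ($\lambda_i$ is the forgetting factor of the $i$-th parameter). $F_\lambda(P_{t-1}^{-1})^{-1}$ denotes the inverse of the matrix $F_\lambda(P_{t-1}^{-1})$, and $I$ is the $p\times p$ identity matrix. *)

theory Defs
  imports "HOL-Analysis.Analysis" "HOL-Library.FuncSet"
begin

definition pos_def_cone :: "(real^'p^'p) set" where
  "pos_def_cone = {A. transpose A = A \<and> (\<forall>x. x \<noteq> 0 \<longrightarrow> 0 < x \<bullet> (A *v x))}"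

definition outer :: "real^'p \<Rightarrow> real^'p \<Rightarrow> real^'p^'p" where
  "outer u v = (\<chi> i j. u $ i * v $ j)"

text \<open>The one-step least-squares cost as a function of the last argument \<open>\<theta>\<close>, with weight \<open>W\<close>
  and previous estimate \<open>\<theta>prev\<close>.\<close>

definition rls_cost ::
    "real^'p^'p \<Rightarrow> real \<Rightarrow> real^'p \<Rightarrow> real^'p \<Rightarrow> real^'p \<Rightarrow> real" where
  "rls_cost W y \<phi> \<theta>prev \<theta> =
     (y - \<phi> \<bullet> \<theta>)\<^sup>2 + (\<theta> - \<theta>prev) \<bullet> (W *v (\<theta> - \<theta>prev))"

end

theory Submission
  imports Defs
begin

text \<open>
  Everything rests on the identity \<open>R = W + \<phi> \<phi>\<^sup>T\<close> with \<open>W = F\<^sub>\<lambda>(R\<^bsub>t-1\<^esub>)\<close> positive definite.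
  In terms of the displacement \<open>d = \<theta> - \<theta>\<^bsub>t-1\<^esub>\<close> and the prediction error
  \<open>e = y(t) - \<phi>\<^sup>T \<theta>\<^bsub>t-1\<^esub>\<close>, the cost equals \<open>e\<^sup>2 - 2 e \<phi>\<^sup>T d + d\<^sup>T R d\<close>, because the data term
  contributes exactly the rank-one matrix that turns \<open>W\<close> into \<open>R\<close>.  As \<open>\<phi> = R K\<close>, completing the
  square puts the vertex at \<open>d = e K\<close> and leaves a quadratic form in \<open>R\<close> as excess
  (\<open>rls_cost_complete_square\<close>).  Positive definiteness of \<open>R\<close> makes this vertex the only
  minimiser.

  The second form of the gain is the Sherman--Morrison formula.  The vector \<open>g = W\<^sup>-\<^sup>1 \<phi>\<close> satisfies
  \<open>R g = (1 + \<phi>\<^sup>T g) \<phi>\<close>, so that \<open>R\<^sup>-\<^sup>1 \<phi>\<close> is a rescaling of \<open>g\<close>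
  (\<open>matrix_inv_add_outer_mult_vec\<close>); and
  \<open>R (I - K \<phi>\<^sup>T) = R - \<phi> \<phi>\<^sup>T = W\<close>, so that \<open>(I - K \<phi>\<^sup>T) W\<^sup>-\<^sup>1\<close> inverts \<open>R\<close>
  (\<open>matrix_inv_add_outer\<close>).

  These arguments concern a single time step.  They apply at every \<open>t\<close> because \<open>F\<^sub>\<lambda>\<close> preserves the
  positive definite cone and adding \<open>\<phi> \<phi>\<^sup>T\<close> does not leave it, so that all \<open>R\<^sub>t\<close> are positive
  definite by induction.
\<close>

lemma outer_mult_vec: "outer u v *v x = (v \<bullet> x) *\<^sub>R u"
  by (simp add: vec_eq_iff outer_def matrix_vector_mult_def inner_vec_def sum_distrib_left
      sum_distrib_right mult_ac)

lemma matrix_mult_outer: "A ** outer u v = outer (A *v u) v"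
  by (simp add: vec_eq_iff outer_def matrix_matrix_mult_def matrix_vector_mult_def
      sum_distrib_left mult_ac)

lemma symmetric_inner_mult_vec:
  fixes A :: "real^'p^'p"
  assumes "transpose A = A"
  shows "x \<bullet> (A *v y) = y \<bullet> (A *v x)"
  by (metis assms dot_lmul_matrix inner_commute transpose_matrix_vector)

lemma matrix_inv_mult:
  fixes A :: "real^'p^'p"
  assumes "invertible A"
  shows "A ** matrix_inv A = mat 1" "matrix_inv A ** A = mat 1"
proof -
  have "A ** matrix_inv A = mat 1 \<and> matrix_inv A ** A = mat 1"
    unfolding matrix_inv_def using assms unfolding invertible_def by (rule someI_ex)
  then show "A ** matrix_inv A = mat 1" "matrix_inv A ** A = mat 1" by auto
qed

lemma matrix_inv_unique_right:
  fixes A :: "real^'p^'p"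
  assumes "invertible A" "A ** B = mat 1"
  shows "matrix_inv A = B"
  by (metis assms matrix_inv_mult(2) matrix_mul_assoc matrix_mul_lid matrix_mul_rid)

lemma invertible_matrix_inv:
  fixes A :: "real^'p^'p"
  assumes "invertible A"
  shows "invertible (matrix_inv A)"
  using matrix_inv_mult[OF assms] unfolding invertible_def by blast

lemma matrix_inv_matrix_inv:
  fixes A :: "real^'p^'p"
  assumes "invertible A"
  shows "matrix_inv (matrix_inv A) = A"
  by (simp add: assms invertible_matrix_inv matrix_inv_mult matrix_inv_unique_right)

lemma pos_def_cone_invertible:
  assumes "A \<in> pos_def_cone"
  shows "invertible A"
proof -
  have "x = 0" if "A *v x = 0" for x
    using assms that unfolding pos_def_cone_def by force
  then show ?thesis
    by (simp add: invertible_left_inverse matrix_left_invertible_ker)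
qed

lemma pos_def_cone_nonneg:
  assumes "A \<in> pos_def_cone"
  shows "0 \<le> x \<bullet> (A *v x)"
  using assms unfolding pos_def_cone_def by (cases "x = 0") (auto intro: less_imp_le)

lemma pos_def_cone_add_outer:
  assumes "W \<in> pos_def_cone"
  shows "W + outer v v \<in> pos_def_cone"
proof -
  have "transpose (W + outer v v) = W + outer v v"
    using assms by (auto simp: pos_def_cone_def transpose_def outer_def vec_eq_iff mult.commute)
  moreover have "0 < x \<bullet> ((W + outer v v) *v x)" if "x \<noteq> 0" for x
  proof -
    have "x \<bullet> ((W + outer v v) *v x) = x \<bullet> (W *v x) + (v \<bullet> x)\<^sup>2"
      by (simp add: matrix_vector_mult_add_rdistrib outer_mult_vec inner_add_right
          inner_commute power2_eq_square)
    then show ?thesis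
      using assms that unfolding pos_def_cone_def by (simp add: add_pos_nonneg)
  qed
  ultimately show ?thesis by (simp add: pos_def_cone_def)
qed

text \<open>The gain enters only through \<open>R k = v\<close>: it expresses the linear term of the cost through \<open>R\<close>,
  which is what makes the square complete.\<close>

lemma rls_cost_complete_square:
  fixes W :: "real^'p^'p" and v \<theta>p :: "real^'p" and y :: real
  assumes sym: "transpose (W + outer v v) = W + outer v v"
    and k: "(W + outer v v) *v k = v"
  defines "c \<equiv> \<theta>p + (y - v \<bullet> \<theta>p) *\<^sub>R k"
  shows "rls_cost W y v \<theta>p \<theta>
       = rls_cost W y v \<theta>p c + (\<theta> - c) \<bullet> ((W + outer v v) *v (\<theta> - c))"
proof -
  define R where "R = W + outer v v"
  define e where "e = y - v \<bullet> \<theta>p"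
  have cost: "rls_cost W y v \<theta>p (\<theta>p + d) = e\<^sup>2 - 2 * e * (v \<bullet> d) + d \<bullet> (R *v d)" for d
    by (simp add: rls_cost_def R_def e_def matrix_vector_mult_add_rdistrib outer_mult_vec
        inner_add_right inner_commute power2_eq_square algebra_simps)
  define d where "d = \<theta> - \<theta>p"
  have kd: "k \<bullet> (R *v d) = v \<bullet> d"
    using symmetric_inner_mult_vec[OF sym, of k d] k by (simp add: R_def inner_commute)
  have Rk: "R *v k = v" using k by (simp add: R_def)
  have "(d - e *\<^sub>R k) \<bullet> (R *v (d - e *\<^sub>R k))
      = d \<bullet> (R *v d) - 2 * e * (v \<bullet> d) + e\<^sup>2 * (v \<bullet> k)"
    by (simp add: matrix_vector_mult_diff_distrib matrix_vector_mult_scaleR inner_diff_left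
        inner_diff_right kd Rk inner_commute power2_eq_square algebra_simps)
  moreover have "rls_cost W y v \<theta>p c = e\<^sup>2 - e\<^sup>2 * (v \<bullet> k)"
    using cost[of "e *\<^sub>R k"]
    unfolding c_def e_def[symmetric]
    by (simp add: matrix_vector_mult_scaleR Rk inner_commute
        power2_eq_square)
  moreover have "rls_cost W y v \<theta>p \<theta> = e\<^sup>2 - 2 * e * (v \<bullet> d) + d \<bullet> (R *v d)"
    using cost[of d] by (simp add: d_def)
  moreover have "\<theta> - c = d - e *\<^sub>R k"
    by (simp add: c_def d_def e_def)
  ultimately show ?thesis by (simp add: R_def)
qed

lemma is_arg_min_rls_cost_iff:
  fixes W :: "real^'p^'p"
  assumes W: "W \<in> pos_def_cone"
  shows "is_arg_min (rls_cost W y v \<theta>p) (\<lambda>_. True) \<theta>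
     \<longleftrightarrow> \<theta> = \<theta>p + (y - v \<bullet> \<theta>p) *\<^sub>R (matrix_inv (W + outer v v) *v v)"
proof -
  define R where "R = W + outer v v"
  define c where "c = \<theta>p + (y - v \<bullet> \<theta>p) *\<^sub>R (matrix_inv R *v v)"
  have R: "R \<in> pos_def_cone"
    unfolding R_def by (rule pos_def_cone_add_outer[OF W])
  have "R *v (matrix_inv R *v v) = v"
    by (simp add: matrix_vector_mul_assoc matrix_inv_mult pos_def_cone_invertible[OF R])
  then have square: "rls_cost W y v \<theta>p \<theta>' = rls_cost W y v \<theta>p c + (\<theta>' - c) \<bullet> (R *v (\<theta>' - c))" for \<theta>'
    using rls_cost_complete_square[of W v "matrix_inv R *v v" y \<theta>p \<theta>'] R
    by (simp add: R_def c_def pos_def_cone_def)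
  have ge: "rls_cost W y v \<theta>p c \<le> rls_cost W y v \<theta>p \<theta>'" for \<theta>'
    using square[of \<theta>'] pos_def_cone_nonneg[OF R, of "\<theta>' - c"] by linarith
  have "rls_cost W y v \<theta>p c < rls_cost W y v \<theta>p \<theta>'" if "\<theta>' \<noteq> c" for \<theta>'
    using square[of \<theta>'] R that by (simp add: pos_def_cone_def)
  then have "is_arg_min (rls_cost W y v \<theta>p) (\<lambda>_. True) \<theta> \<longleftrightarrow> \<theta> = c"
    using ge unfolding is_arg_min_def by (metis not_less)
  then show ?thesis by (simp add: c_def R_def)
qed

text \<open>Positive definiteness, beyond invertibility of \<open>W\<close>, gives \<open>v\<^sup>T W\<^sup>-\<^sup>1 v \<ge> 0\<close>, which keeps the
  denominator away from zero.\<close>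

lemma matrix_inv_add_outer_mult_vec:
  fixes W :: "real^'p^'p"
  assumes W: "W \<in> pos_def_cone"
  shows "matrix_inv (W + outer v v) *v v
       = (matrix_inv W *v v) /\<^sub>R (1 + v \<bullet> (matrix_inv W *v v))"
proof -
  define R where "R = W + outer v v"
  define g where "g = matrix_inv W *v v"
  have invR: "invertible R"
    unfolding R_def by (intro pos_def_cone_invertible pos_def_cone_add_outer W)
  have Wg: "W *v g = v"
    by (simp add: g_def matrix_vector_mul_assoc matrix_inv_mult pos_def_cone_invertible[OF W])
  then have nonneg: "0 \<le> v \<bullet> g"
    using pos_def_cone_nonneg[OF W, of g] by (simp add: inner_commute)
  have "R *v g = (1 + v \<bullet> g) *\<^sub>R v"
    by (simp add: R_def matrix_vector_mult_add_rdistrib Wg outer_mult_vec scaleR_add_left)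
  then have "matrix_inv R *v (R *v g) = (1 + v \<bullet> g) *\<^sub>R (matrix_inv R *v v)"
    by (simp add: matrix_vector_mult_scaleR)
  then have "g = (1 + v \<bullet> g) *\<^sub>R (matrix_inv R *v v)"
    by (simp add: matrix_vector_mul_assoc matrix_inv_mult[OF invR])
  then have "g /\<^sub>R (1 + v \<bullet> g)
      = ((1 + v \<bullet> g) *\<^sub>R (matrix_inv R *v v)) /\<^sub>R (1 + v \<bullet> g)"
    by (rule arg_cong)
  also have "\<dots> = matrix_inv R *v v"
    using nonneg by simp
  finally show ?thesis by (simp add: R_def g_def)
qed

lemma matrix_inv_add_outer:
  fixes W :: "real^'p^'p"
  assumes W: "invertible W" and R: "invertible (W + outer v v)"
  shows "matrix_inv (W + outer v v)
       = (mat 1 - outer (matrix_inv (W + outer v v) *v v) v) ** matrix_inv W"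
proof (rule matrix_inv_unique_right[OF R])
  let ?R = "W + outer v v"
  have "?R ** (mat 1 - outer (matrix_inv ?R *v v) v) = ?R - outer (?R *v (matrix_inv ?R *v v)) v"
    using matrix_add_ldistrib[of ?R "mat 1 - outer (matrix_inv ?R *v v) v"
        "outer (matrix_inv ?R *v v) v"]
    by (simp add: matrix_mult_outer eq_diff_eq)
  also have "\<dots> = W"
    by (simp only: matrix_vector_mul_assoc matrix_inv_mult[OF R] matrix_vector_mul_lid) simp
  finally show "?R ** ((mat 1 - outer (matrix_inv ?R *v v) v) ** matrix_inv W) = mat 1"
    by (simp add: matrix_mul_assoc matrix_inv_mult[OF W])
qed

theorem mainTheorem2:
  fixes lam :: "real^'p"
    and F :: "real^'p \<Rightarrow> real^'p^'p \<Rightarrow> real^'p^'p"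
    and y :: "nat \<Rightarrow> real"
    and \<phi> :: "nat \<Rightarrow> real^'p"
    and \<theta>0 :: "real^'p"
    and R0 :: "real^'p^'p"
    and \<theta> :: "nat \<Rightarrow> real^'p"
    and R P :: "nat \<Rightarrow> real^'p^'p"
    and K :: "nat \<Rightarrow> real^'p"
  assumes lam: "\<And>i. 0 < lam $ i \<and> lam $ i < 1"
    and F: "F lam \<in> pos_def_cone \<rightarrow> pos_def_cone"
    and R0: "R0 \<in> pos_def_cone"
    and theta_init: "\<theta> 0 = \<theta>0"
    and theta_step: "\<And>t. t \<ge> 1 \<Longrightarrow>
          \<theta> t = arg_min (rls_cost (F lam (R (t - 1))) (y t) (\<phi> t) (\<theta> (t - 1))) (\<lambda>_. True)"
    and R_init: "R 0 = R0"
    and R_step: "\<And>t. t \<ge> 1 \<Longrightarrow> R t = F lam (R (t - 1)) + outer (\<phi> t) (\<phi> t)"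
    and K_def: "\<And>t. t \<ge> 1 \<Longrightarrow> K t = matrix_inv (R t) *v \<phi> t"
    and P_def: "\<And>t. P t = matrix_inv (R t)"
  shows "\<forall>t\<ge>1.
      \<comment> \<open>the argmin and the inverses are meaningful\<close>
      (\<forall>\<theta>'. is_arg_min (rls_cost (F lam (R (t - 1))) (y t) (\<phi> t) (\<theta> (t - 1))) (\<lambda>_. True) \<theta>'
             \<longleftrightarrow> \<theta>' = \<theta> t) \<and>
      invertible (R t) \<and> invertible (P (t - 1)) \<and> invertible (F lam (matrix_inv (P (t - 1)))) \<and>
      \<comment> \<open>the solution is given by the recursion\<close>
      \<theta> t = \<theta> (t - 1) + (y t - \<phi> t \<bullet> \<theta> (t - 1)) *\<^sub>R K t \<and>
      K t = matrix_inv (R t) *v \<phi> t \<and>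
      R t = F lam (R (t - 1)) + outer (\<phi> t) (\<phi> t) \<and>
      \<comment> \<open>equivalent update of the gain\<close>
      K t = (matrix_inv (F lam (matrix_inv (P (t - 1)))) *v \<phi> t)
              /\<^sub>R (1 + \<phi> t \<bullet> (matrix_inv (F lam (matrix_inv (P (t - 1)))) *v \<phi> t)) \<and>
      P t = (mat 1 - outer (K t) (\<phi> t)) ** matrix_inv (F lam (matrix_inv (P (t - 1))))"
proof (intro allI impI)
  have R_pos: "R t \<in> pos_def_cone" for t
  proof (induction t)
    case 0
    show ?case using R0 R_init by simp
  next
    case (Suc t)
    then show ?case using R_step[of "Suc t"] F pos_def_cone_add_outer by (auto simp: Pi_iff)
  qed
  fix t :: nat
  assume t: "t \<ge> 1"
  define W where "W = F lam (R (t - 1))"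
  have W: "W \<in> pos_def_cone"
    using F R_pos by (auto simp: W_def Pi_iff)
  have Rt: "R t = W + outer (\<phi> t) (\<phi> t)"
    using R_step[OF t] by (simp add: W_def)
  have invR: "invertible (R s)" for s
    by (rule pos_def_cone_invertible[OF R_pos])
  have FP: "F lam (matrix_inv (P (t - 1))) = W"
    by (simp add: P_def W_def matrix_inv_matrix_inv[OF invR])
  have argmin: "is_arg_min (rls_cost W (y t) (\<phi> t) (\<theta> (t - 1))) (\<lambda>_. True) \<theta>'
      \<longleftrightarrow> \<theta>' = \<theta> (t - 1) + (y t - \<phi> t \<bullet> \<theta> (t - 1)) *\<^sub>R K t" for \<theta>'
    using is_arg_min_rls_cost_iff[OF W] by (simp add: K_def[OF t] Rt)
  have \<theta>: "\<theta> t = \<theta> (t - 1) + (y t - \<phi> t \<bullet> \<theta> (t - 1)) *\<^sub>R K t"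
    using theta_step[OF t] argmin unfolding arg_min_def W_def[symmetric]
    by (metis (mono_tags, lifting) someI)
  have gain: "K t = (matrix_inv W *v \<phi> t) /\<^sub>R (1 + \<phi> t \<bullet> (matrix_inv W *v \<phi> t))"
    using matrix_inv_add_outer_mult_vec[OF W] by (simp add: K_def[OF t] Rt)
  have cov: "P t = (mat 1 - outer (K t) (\<phi> t)) ** matrix_inv W"
    using matrix_inv_add_outer[OF pos_def_cone_invertible[OF W], of "\<phi> t"] invR[of t]
    by (simp add: P_def K_def[OF t] Rt)
  have argmin': "\<forall>\<theta>'. is_arg_min (rls_cost W (y t) (\<phi> t) (\<theta> (t - 1))) (\<lambda>_. True) \<theta>'
      \<longleftrightarrow> \<theta>' = \<theta> t"
    using argmin \<theta> by simp
  show "(\<forall>\<theta>'. is_arg_min (rls_cost (F lam (R (t - 1))) (y t) (\<phi> t) (\<theta> (t - 1))) (\<lambda>_. True) \<theta>'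
             \<longleftrightarrow> \<theta>' = \<theta> t) \<and>
      invertible (R t) \<and> invertible (P (t - 1)) \<and> invertible (F lam (matrix_inv (P (t - 1)))) \<and>
      \<theta> t = \<theta> (t - 1) + (y t - \<phi> t \<bullet> \<theta> (t - 1)) *\<^sub>R K t \<and>
      K t = matrix_inv (R t) *v \<phi> t \<and>
      R t = F lam (R (t - 1)) + outer (\<phi> t) (\<phi> t) \<and>
      K t = (matrix_inv (F lam (matrix_inv (P (t - 1)))) *v \<phi> t)
              /\<^sub>R (1 + \<phi> t \<bullet> (matrix_inv (F lam (matrix_inv (P (t - 1)))) *v \<phi> t)) \<and>
      P t = (mat 1 - outer (K t) (\<phi> t)) ** matrix_inv (F lam (matrix_inv (P (t - 1))))"
    unfolding FP
    using argmin' \<theta> gain cov K_def[OF t] Rt invR[of t] pos_def_cone_invertible[OF W]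
      invertible_matrix_inv[OF invR[of "t - 1"]] P_def[of "t - 1"]
    unfolding W_def by (intro conjI) simp_all
qed

end
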